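(* Let $M(t)$ be a smoothly varying $n\times n$ matrix, depending on a real parameter $t$ and having simple eigenvalues. Suppose $M(t)$ is real. Let $\lambda_i(t)$ and $\overline{\lambda_i(t)}$ be a complex conjugate pair of eigenvalues of $M(t)$ which is not degenerate (that is, $\lambda_i(t)\neq\overline{\lambda_i(t)}$), and suppose that $\mathbf{u}_i^{T}(t)\,\dot M(t)\,\mathbf{v}_i(t)\neq 0$. Then $\lambda_i(t)$ and $\overline{\lambda_i(t)}$ attract each other.
   Context: Dots denote derivatives in $t$. The eigenvalues of $M(t)$ are $\lambda_1(t),\dots,\lambda_n(t)$ (simple). $\mathbf{v}_i(t)$ is a unit ($2$-norm) right eigenvector, $M\mathbf{v}_i=\lambda_i\mathbf{v}_i$, and $\mathbf{u}_i^*(t)$ are the dual left eigenvectors, $\mathbf{u}_i^*M=\lambda_i\mathbf{u}_i^*$: $\mathbf{u}_j^*$ is the $j$-th row of $\mathbf{V}^{-1}$ with $\mathbf{V}=[\mathbf{v}_1,\dots,\mathbf{v}_n]$, so $\mathbf{u}_j^*\mathbf{v}_i=\delta_{ij}$. Here $^*$ is the conjugate transpose and $^T$ the plain transpose. For real $M(t)$ the eigenvectors of $\overline{\lambda_i}$ are taken to be $\overline{\mathbf{v}_i}$ and $\overline{\mathbf{u}_i}$. Set $c_{ij}=\mathbf{u}_i^*(t)\,\dot M(t)\,\mathbf{v}_j(t)$. The eigenvalues satisfy $$\ddot\lambda_i=\mathbf{u}_i^*\ddot M\mathbf{v}_i+2\sum_{j\neq i}\frac{c_{ij}c_{ji}}{\lambda_i-\lambda_j},$$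 and the force of $\lambda_j$ on $\lambda_i$ is by definition $F_{j\to i}=\dfrac{2c_{ij}c_{ji}}{\lambda_i-\lambda_j}\in\mathbb{C}$. The force between $\lambda_i$ and $\lambda_j$ is called central if $F_{j\to i}=f\cdot(\lambda_i-\lambda_j)$ with $f$ real. $\lambda_j$ attracts (repels) $\lambda_i$ if the force between them is central and $f$ is negative (positive). Two eigenvalues attract each other if each attracts the other. *)

theory Defs
  imports "HOL-Analysis.Analysis" "HOL-Computational_Algebra.Polynomial"
begin

(* C^infinity on an open set T of parameter values. *)
definition smooth_curve_on :: "real set \<Rightarrow> (real \<Rightarrow> 'a::real_normed_vector) \<Rightarrow> bool" where
  "smooth_curve_on T f \<longleftrightarrow>
     (\<forall>k. ((\<lambda>g s. vector_derivative g (at s)) ^^ k) f differentiable_on T)"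

definition real_matrix :: "complex ^ 'n ^ 'm \<Rightarrow> bool" where
  "real_matrix A \<longleftrightarrow> (\<forall>a b. A $ a $ b \<in> \<real>)"

definition charpoly :: "complex ^ 'n ^ 'n \<Rightarrow> complex poly" where
  "charpoly A = det (mat [:0, 1:] - (\<chi> a b. [:A $ a $ b:]))"

(* lam lists the eigenvalues of A with algebraic multiplicity, and each of them is simple. *)
definition simple_eigenvalues :: "complex ^ 'n ^ 'n \<Rightarrow> ('n \<Rightarrow> complex) \<Rightarrow> bool" where
  "simple_eigenvalues A lam \<longleftrightarrow> charpoly A = (\<Prod>i\<in>UNIV. [:- lam i, 1:]) \<and> inj lam"

(* The norm of complex ^ 'n is the 2-norm. *)
definition eigensystem ::
    "complex ^ 'n ^ 'n \<Rightarrow> ('n \<Rightarrow> complex) \<Rightarrow> ('n \<Rightarrow> complex ^ 'n) \<Rightarrow> bool" where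
  "eigensystem A lam v \<longleftrightarrow>
     simple_eigenvalues A lam \<and> (\<forall>i. A *v v i = lam i *s v i \<and> norm (v i) = 1)"

definition cnj_vec :: "complex ^ 'n \<Rightarrow> complex ^ 'n" where
  "cnj_vec x = (\<chi> a. cnj (x $ a))"

(* The plain-transpose form x^T A y; the form x^* A y is tform (cnj_vec x) A y. *)
definition tform :: "complex ^ 'n \<Rightarrow> complex ^ 'n ^ 'n \<Rightarrow> complex ^ 'n \<Rightarrow> complex" where
  "tform x A y = (\<Sum>a\<in>UNIV. x $ a * (A *v y) $ a)"

(* The matrix whose i-th column is v i. *)
definition column_matrix :: "('n \<Rightarrow> complex ^ 'n) \<Rightarrow> complex ^ 'n ^ 'n" where
  "column_matrix v = (\<chi> a i. v i $ a)"

(* The column vector u_j; it is u_j^*, not u_j^T, that is the j-th row of the inverse,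
   hence the conjugation. *)
definition dual_vec :: "('n \<Rightarrow> complex ^ 'n) \<Rightarrow> 'n \<Rightarrow> complex ^ 'n" where
  "dual_vec v j = cnj_vec (row j (matrix_inv (column_matrix v)))"

definition coupling ::
    "(real \<Rightarrow> complex ^ 'n ^ 'n) \<Rightarrow> (real \<Rightarrow> 'n \<Rightarrow> complex ^ 'n) \<Rightarrow> real \<Rightarrow> 'n \<Rightarrow> 'n \<Rightarrow> complex" where
  "coupling M v t i j =
     tform (cnj_vec (dual_vec (v t) i)) (vector_derivative M (at t)) (v t j)"

(* force M lam v t j i is the force exerted by the j-th eigenvalue on the i-th one. *)
definition force ::
    "(real \<Rightarrow> complex ^ 'n ^ 'n) \<Rightarrow> (real \<Rightarrow> 'n \<Rightarrow> complex) \<Rightarrow> (real \<Rightarrow> 'n \<Rightarrow> complex ^ 'n)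
      \<Rightarrow> real \<Rightarrow> 'n \<Rightarrow> 'n \<Rightarrow> complex" where
  "force M lam v t j i =
     2 * coupling M v t i j * coupling M v t j i / (lam t i - lam t j)"

definition central_force ::
    "(real \<Rightarrow> complex ^ 'n ^ 'n) \<Rightarrow> (real \<Rightarrow> 'n \<Rightarrow> complex) \<Rightarrow> (real \<Rightarrow> 'n \<Rightarrow> complex ^ 'n)
      \<Rightarrow> real \<Rightarrow> 'n \<Rightarrow> 'n \<Rightarrow> real \<Rightarrow> bool" where
  "central_force M lam v t j i f \<longleftrightarrow>
     force M lam v t j i = of_real f * (lam t i - lam t j)"

(* The j-th eigenvalue attracts the i-th one at time t. *)
definition attracts ::
    "(real \<Rightarrow> complex ^ 'n ^ 'n) \<Rightarrow> (real \<Rightarrow> 'n \<Rightarrow> complex) \<Rightarrow> (real \<Rightarrow> 'n \<Rightarrow> complex ^ 'n)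
      \<Rightarrow> real \<Rightarrow> 'n \<Rightarrow> 'n \<Rightarrow> bool" where
  "attracts M lam v t j i \<longleftrightarrow> (\<exists>f. central_force M lam v t j i f \<and> f < 0)"

definition attract_each_other ::
    "(real \<Rightarrow> complex ^ 'n ^ 'n) \<Rightarrow> (real \<Rightarrow> 'n \<Rightarrow> complex) \<Rightarrow> (real \<Rightarrow> 'n \<Rightarrow> complex ^ 'n)
      \<Rightarrow> real \<Rightarrow> 'n \<Rightarrow> 'n \<Rightarrow> bool" where
  "attract_each_other M lam v t i j \<longleftrightarrow> attracts M lam v t j i \<and> attracts M lam v t i j"

end

theory Submission imports Defs begin

text \<open>
  Write \<open>w\<^sub>i\<close> for the \<open>i\<close>-th row of \<open>V\<^sup>-\<^sup>1\<close>, so that \<open>c\<^sub>i\<^sub>j = w\<^sub>i M' v\<^sub>j\<close>, where \<open>M'\<close> is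
  the derivative of \<open>M\<close>.  The theorem rests on the identity \<open>w\<^sub>j = cnj w\<^sub>i\<close> for the
  conjugate pair \<open>lam j = cnj (lam i)\<close> (\<open>dual_vec_cnj\<close>).  Since \<open>M'\<close> is real
  (\<open>real_matrix_vector_derivative\<close>), it gives \<open>c\<^sub>i\<^sub>j = cnj c\<^sub>j\<^sub>i\<close>, so the numerator of the
  force is \<open>2 \<bar>c\<^sub>j\<^sub>i\<bar>\<^sup>2\<close>.  The difference \<open>lam i - lam j\<close> is purely imaginary, so its square is
  a negative real number, and therefore the force
  \<open>2 \<bar>c\<^sub>j\<^sub>i\<bar>\<^sup>2 / (lam i - lam j) = (2 \<bar>c\<^sub>j\<^sub>i\<bar>\<^sup>2 / (lam i - lam j)\<^sup>2) (lam i - lam j)\<close>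
  is central with a negative factor.  The factor does not vanish, because \<open>u\<^sub>i = cnj w\<^sub>i = w\<^sub>j\<close>
  as a plain vector, which turns the hypothesis on \<open>u\<^sub>i\<^sup>T M' v\<^sub>i\<close> into \<open>c\<^sub>j\<^sub>i \<noteq> 0\<close>.

  The identity \<open>w\<^sub>j = cnj w\<^sub>i\<close> itself is biorthogonality: conjugating \<open>w\<^sub>i M = lam i w\<^sub>i\<close> for
  real \<open>M\<close> makes \<open>cnj w\<^sub>i\<close> a left eigenvector for \<open>lam j\<close>; it annihilates every \<open>v\<^sub>k\<close> with
  \<open>k \<noteq> j\<close> and pairs to 1 with \<open>v\<^sub>j = cnj v\<^sub>i\<close>, and these
  pairings characterise \<open>w\<^sub>j\<close> (\<open>dual_vec_unique\<close>).
\<close>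

section \<open>Eigenbases and their dual bases\<close>

text \<open>
  Applying \<open>A - lam b\<close> to a vanishing combination removes the \<open>b\<close>-th term and multiplies each
  other term by \<open>lam k - lam b \<noteq> 0\<close>, so the number of terms can be lowered by induction.
\<close>

lemma eigenvector_combination_eq_0:
  fixes A :: "'a::field ^ 'n ^ 'n" and v :: "'i \<Rightarrow> 'a ^ 'n"
  assumes "finite S" and "inj_on lam S"
    and "\<And>k. k \<in> S \<Longrightarrow> A *v v k = lam k *s v k"
    and "\<And>k. k \<in> S \<Longrightarrow> v k \<noteq> 0"
    and "(\<Sum>k\<in>S. x k *s v k) = 0"
  shows "\<forall>k\<in>S. x k = 0"
  using assms
proof (induction S arbitrary: x rule: finite_induct)
  case empty
  then show ?case by simp
next
  case (insert b S)
  have eig: "A *v v k = lam k *s v k" if "k \<in> insert b S" for k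
    using insert.prems(2) that by blast
  have sum0: "x b *s v b + (\<Sum>k\<in>S. x k *s v k) = 0"
    using insert.prems(4) insert.hyps by simp
  have "(\<Sum>k\<in>S. (x k * (lam k - lam b)) *s v k)
      = (\<Sum>k\<in>insert b S. (x k * (lam k - lam b)) *s v k)"
    using insert.hyps by simp
  also have "\<dots> = (\<Sum>k\<in>insert b S. A *v (x k *s v k)) - lam b *s (\<Sum>k\<in>insert b S. x k *s v k)"
    unfolding vec.scale_sum_right sum_subtractf[symmetric]
    by (intro sum.cong refl)
       (simp add: eig vec.scale vec_eq_iff algebra_simps)
  also have "\<dots> = A *v (\<Sum>k\<in>insert b S. x k *s v k) - lam b *s (\<Sum>k\<in>insert b S. x k *s v k)"
    by (simp only: vec.sum)
  also have "\<dots> = 0"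
    by (simp only: insert.prems(4)) simp
  finally have "\<forall>k\<in>S. x k * (lam k - lam b) = 0"
    using insert.IH[of "\<lambda>k. x k * (lam k - lam b)"] insert.prems by (auto simp: inj_on_def)
  moreover have "lam k - lam b \<noteq> 0" if "k \<in> S" for k
    using insert.prems(1) insert.hyps that by (auto simp: inj_on_def)
  ultimately have xS: "\<forall>k\<in>S. x k = 0"
    by simp
  then have "x b *s v b = 0"
    using sum0 by simp
  then show ?case
    using xS insert.prems(3)[of b] by simp
qed

lemma
  assumes "invertible A"
  shows matrix_inv_right: "A ** matrix_inv A = mat 1"
    and matrix_inv_left: "matrix_inv A ** A = mat 1"
  using someI_ex[OF assms[unfolded invertible_def]] by (simp_all add: matrix_inv_def)

lemma column_matrix_mult_eq_sum: "column_matrix v *v x = (\<Sum>k\<in>UNIV. x $ k *s v k)"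
  by (simp add: vec_eq_iff column_matrix_def matrix_vector_mult_def mult.commute)

lemma invertible_column_matrix_eigensystem:
  assumes "eigensystem A lam v"
  shows "invertible (column_matrix v)"
proof -
  have eig: "A *v v k = lam k *s v k" and unit: "norm (v k) = 1" for k
    using assms by (simp_all add: eigensystem_def)
  have inj: "inj lam"
    using assms by (simp add: eigensystem_def simple_eigenvalues_def)
  have nz: "v k \<noteq> 0" for k
    using unit[of k] by auto
  have "x = 0" if "column_matrix v *v x = 0" for x
  proof -
    have "(\<Sum>k\<in>UNIV. x $ k *s v k) = 0"
      using that by (simp only: column_matrix_mult_eq_sum)
    then have "\<forall>k\<in>UNIV. x $ k = 0"
      by (intro eigenvector_combination_eq_0[OF finite inj eig nz])
    then show ?thesis
      by (simp add: vec_eq_iff)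
  qed
  then have "\<exists>B. B ** column_matrix v = mat 1"
    by (simp only: matrix_left_invertible_ker) blast
  then show ?thesis
    by (simp only: invertible_left_inverse)
qed

lemma cnj_vec_cnj_vec [simp]: "cnj_vec (cnj_vec x) = x"
  by (simp add: cnj_vec_def vec_eq_iff)

lemma matrix_mult_cnj_vec:
  assumes "real_matrix A"
  shows "A *v cnj_vec y = cnj_vec (A *v y)"
  using assms by (simp add: vec_eq_iff cnj_vec_def matrix_vector_mult_def real_matrix_def
      Reals_cnj_iff)

lemma cnj_tform:
  assumes "real_matrix A"
  shows "cnj (tform x A y) = tform (cnj_vec x) A (cnj_vec y)"
  by (simp add: tform_def matrix_mult_cnj_vec[OF assms]) (simp add: cnj_vec_def)

lemma dual_vec_pairing:
  assumes "invertible (column_matrix v)"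
  shows "(\<Sum>a\<in>UNIV. cnj (dual_vec v i $ a) * v k $ a) = (if i = k then 1 else 0)"
proof -
  have "(matrix_inv (column_matrix v) ** column_matrix v) $ i $ k = mat 1 $ i $ k"
    using matrix_inv_left[OF assms] by simp
  then show ?thesis
    by (simp add: matrix_matrix_mult_def column_matrix_def dual_vec_def cnj_vec_def row_def mat_def)
qed

lemma dual_vec_unique:
  assumes "invertible (column_matrix v)"
    and "\<And>k. (\<Sum>a\<in>UNIV. cnj (r $ a) * v k $ a) = (if k = j then 1 else 0)"
  shows "r = dual_vec v j"
proof -
  have "cnj_vec r v* column_matrix v = axis j 1"
    using assms(2)
    by (simp add: vec_eq_iff vector_matrix_mult_def column_matrix_def cnj_vec_def axis_def
        mult.commute)
  then have "cnj_vec r v* (column_matrix v ** matrix_inv (column_matrix v))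
      = axis j 1 v* matrix_inv (column_matrix v)"
    by (simp add: vector_matrix_mul_assoc[symmetric])
  then have "cnj_vec r = axis j 1 v* matrix_inv (column_matrix v)"
    by (simp add: matrix_inv_right[OF assms(1)])
  also have "\<dots> = row j (matrix_inv (column_matrix v))"
    by (simp add: vec_eq_iff vector_matrix_mult_def axis_def row_def mult_delta_left)
  finally have "cnj_vec (cnj_vec r) = dual_vec v j"
    by (simp only: dual_vec_def)
  then show ?thesis
    by simp
qed

text \<open>
  Both sides are linear in \<open>y\<close> and agree on the eigenbasis: for \<open>y = v k\<close> each is
  \<open>lam i\<close> if \<open>k = i\<close> and 0 otherwise.
\<close>

lemma dual_vec_left_eigenvector:
  assumes "eigensystem A lam v"
  shows "tform (cnj_vec (dual_vec v i)) A y = lam i * (\<Sum>a\<in>UNIV. cnj (dual_vec v i $ a) * y $ a)"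
proof -
  note inv = invertible_column_matrix_eigensystem[OF assms]
  have eig: "\<And>k. A *v v k = lam k *s v k"
    using assms by (simp add: eigensystem_def)
  define c where "c = matrix_inv (column_matrix v) *v y"
  have "column_matrix v *v c = y"
    by (simp add: c_def matrix_vector_mul_assoc matrix_inv_right[OF inv])
  then have y: "y = (\<Sum>k\<in>UNIV. c $ k *s v k)"
    by (simp add: column_matrix_mult_eq_sum)
  have pair: "(\<Sum>a\<in>UNIV. cnj (dual_vec v i $ a) * (\<Sum>k\<in>UNIV. d k *s v k) $ a) = d i" for d
  proof -
    have "(\<Sum>a\<in>UNIV. cnj (dual_vec v i $ a) * (\<Sum>k\<in>UNIV. d k *s v k) $ a)
        = (\<Sum>a\<in>UNIV. \<Sum>k\<in>UNIV. d k * (cnj (dual_vec v i $ a) * v k $ a))"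
      by (simp add: sum_distrib_left mult.left_commute)
    also have "\<dots> = (\<Sum>k\<in>UNIV. d k * (\<Sum>a\<in>UNIV. cnj (dual_vec v i $ a) * v k $ a))"
      by (subst sum.swap) (simp add: sum_distrib_left)
    also have "\<dots> = d i"
      by (simp add: dual_vec_pairing[OF inv] if_distrib cong: if_cong)
    finally show ?thesis .
  qed
  have "A *v y = (\<Sum>k\<in>UNIV. (c $ k * lam k) *s v k)"
    by (simp add: y vec.sum vec.scale eig)
  then have "tform (cnj_vec (dual_vec v i)) A y = c $ i * lam i"
    by (simp only: tform_def cnj_vec_def vec_lambda_beta pair)
  also have "c $ i = (\<Sum>a\<in>UNIV. cnj (dual_vec v i $ a) * y $ a)"
    by (subst y) (simp only: pair)
  finally show ?thesis
    by (simp add: mult.commute)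
qed

text \<open>
  Conjugating the left eigenvector equation of \<open>w\<^sub>i\<close> shows that \<open>cnj w\<^sub>i\<close> is a left eigenvector
  for \<open>lam j\<close>.  Left and right eigenvectors of distinct eigenvalues are orthogonal, so it has
  the pairings with the \<open>v\<^sub>k\<close> that determine \<open>w\<^sub>j\<close>.
\<close>

lemma dual_vec_cnj:
  assumes sys: "eigensystem A lam v" and real: "real_matrix A"
    and lam: "lam j = cnj (lam i)" and v: "v j = cnj_vec (v i)"
  shows "dual_vec v j = cnj_vec (dual_vec v i)"
proof -
  note inv = invertible_column_matrix_eigensystem[OF sys]
  have eig: "\<And>k. A *v v k = lam k *s v k" and inj: "inj lam"
    using sys by (auto simp: eigensystem_def simple_eigenvalues_def)
  define p where "p k = (\<Sum>a\<in>UNIV. dual_vec v i $ a * v k $ a)" for k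
  have "p k = (if k = j then 1 else 0)" for k
  proof (cases "k = j")
    case True
    have "cnj (p j) = (\<Sum>a\<in>UNIV. cnj (dual_vec v i $ a) * v i $ a)"
      by (simp add: p_def v cnj_vec_def)
    also have "\<dots> = 1"
      by (simp add: dual_vec_pairing[OF inv])
    finally show ?thesis
      using True by (metis complex_cnj_cnj complex_cnj_one)
  next
    case False
    have "lam j * p k = cnj (tform (cnj_vec (dual_vec v i)) A (cnj_vec (v k)))"
      unfolding dual_vec_left_eigenvector[OF sys] by (simp add: p_def lam cnj_vec_def)
    also have "\<dots> = tform (dual_vec v i) A (v k)"
      by (simp add: cnj_tform[OF real])
    also have "\<dots> = lam k * p k"
      by (simp add: tform_def eig p_def sum_distrib_left mult.left_commute)
    finally have "lam j * p k = lam k * p k" .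
    moreover have "lam j \<noteq> lam k"
      using inj False by (auto dest: injD)
    ultimately show ?thesis
      using False by simp
  qed
  then show ?thesis
    by (intro dual_vec_unique[OF inv, symmetric]) (simp add: p_def cnj_vec_def)
qed

section \<open>Conjugate pairs attract\<close>

lemma real_matrix_vector_derivative:
  fixes M :: "real \<Rightarrow> complex ^ 'n ^ 'm"
  assumes "open T" and "t \<in> T" and "M differentiable (at t)"
    and "\<And>s. s \<in> T \<Longrightarrow> real_matrix (M s)"
  shows "real_matrix (vector_derivative M (at t))"
  unfolding real_matrix_def
proof (intro allI)
  fix a b
  have "bounded_linear (\<lambda>A :: complex ^ 'n ^ 'm. Im (A $ a $ b))"
    by (rule bounded_linear_compose[OF bounded_linear_Im
        bounded_linear_compose[OF bounded_linear_vec_nth bounded_linear_vec_nth]])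
  moreover have "(M has_vector_derivative vector_derivative M (at t)) (at t)"
    using assms(3) by (simp add: vector_derivative_works)
  ultimately have "((\<lambda>s. Im (M s $ a $ b)) has_vector_derivative
      Im (vector_derivative M (at t) $ a $ b)) (at t)"
    by (rule bounded_linear.has_vector_derivative)
  then have "((\<lambda>s. 0 :: real) has_vector_derivative
      Im (vector_derivative M (at t) $ a $ b)) (at t)"
    by (rule has_vector_derivative_transform_within_open[OF _ assms(1,2)])
       (use assms(4) in \<open>simp add: real_matrix_def complex_is_Real_iff\<close>)
  then have "Im (vector_derivative M (at t) $ a $ b) = 0"
    using vector_derivative_unique_at has_vector_derivative_const by blast
  then show "vector_derivative M (at t) $ a $ b \<in> \<real>"
    by (simp add: complex_is_Real_iff)
qed

text \<open>
  The numerator of the force is \<open>2 \<bar>c\<^sub>l\<^sub>k\<bar>\<^sup>2 > 0\<close>, while \<open>lam k - lam l = \<i> y\<close> with \<open>y = 2 Im (lam k)\<close>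
  real; dividing twice by \<open>\<i> y\<close> produces the factor \<open>-1 / y\<^sup>2\<close> and hence the sign of attraction.
  Stated for an arbitrary pair of indices so that both directions of the attraction, with
  \<open>k\<close> and \<open>l\<close> exchanged, are instances.
\<close>

lemma attracts_if_couplings_conjugate:
  assumes lam: "lam t l = cnj (lam t k)" and nonreal: "lam t k \<noteq> lam t l"
    and c: "coupling M v t k l = cnj (coupling M v t l k)"
    and nz: "coupling M v t l k \<noteq> 0"
  shows "attracts M lam v t l k"
proof -
  define y where "y = 2 * Im (lam t k)"
  have diff: "lam t k - lam t l = \<i> * of_real y"
    by (simp add: lam y_def complex_eq_iff)
  have "y \<noteq> 0"
    using nonreal diff by auto
  define f where "f = - (2 * (cmod (coupling M v t l k))\<^sup>2) / y\<^sup>2"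
  have "f < 0"
    using nz \<open>y \<noteq> 0\<close> by (simp add: f_def)
  have "coupling M v t k l * coupling M v t l k = of_real ((cmod (coupling M v t l k))\<^sup>2)"
    by (simp only: c complex_norm_square mult.commute)
  then have "force M lam v t l k = 2 * of_real ((cmod (coupling M v t l k))\<^sup>2) / (\<i> * of_real y)"
    by (simp only: force_def diff mult.assoc)
  also have "\<dots> = of_real f * (\<i> * of_real y)"
    using \<open>y \<noteq> 0\<close> by (simp add: f_def field_simps power2_eq_square)
  finally have "central_force M lam v t l k f"
    by (simp add: central_force_def diff)
  with \<open>f < 0\<close> show ?thesis
    by (auto simp: attracts_def)
qed

theorem theorem1:
  fixes M :: "real \<Rightarrow> complex ^ 'n ^ 'n"
    and lam :: "real \<Rightarrow> 'n \<Rightarrow> complex"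
    and v :: "real \<Rightarrow> 'n \<Rightarrow> complex ^ 'n"
    and T :: "real set" and t :: real and i j :: 'n
  assumes "open T" and "t \<in> T"
    and "smooth_curve_on T M"
    and "\<And>s. s \<in> T \<Longrightarrow> eigensystem (M s) (lam s) (v s)"
    and "\<And>s. s \<in> T \<Longrightarrow> real_matrix (M s)"
    and "\<And>s k l. s \<in> T \<Longrightarrow> k \<noteq> l \<Longrightarrow> lam s l = cnj (lam s k) \<Longrightarrow> v s l = cnj_vec (v s k)"
    and "lam t j = cnj (lam t i)"
    and "lam t i \<noteq> cnj (lam t i)"
    and "tform (dual_vec (v t) i) (vector_derivative M (at t)) (v t i) \<noteq> 0"
  shows "attract_each_other M lam v t i j"
proof -
  have "i \<noteq> j"
    using assms(7,8) by auto
  then have vj: "v t j = cnj_vec (v t i)"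
    using assms(2,6,7) by blast
  have uj: "dual_vec (v t) j = cnj_vec (dual_vec (v t) i)"
    by (rule dual_vec_cnj[OF assms(4)[OF assms(2)] assms(5)[OF assms(2)] assms(7) vj])
  \<comment> \<open>The 0-th iterated derivative is the curve itself.\<close>
  have "M differentiable_on T"
    using assms(3)[unfolded smooth_curve_on_def, rule_format, of 0] by simp
  then have "M differentiable (at t)"
    using assms(1,2) by (simp add: differentiable_on_eq_differentiable_at)
  then have real: "real_matrix (vector_derivative M (at t))"
    using assms(1,2,5) by (intro real_matrix_vector_derivative)
  have c: "coupling M v t i j = cnj (coupling M v t j i)"
    by (simp add: coupling_def cnj_tform[OF real] uj vj)
  have nz: "coupling M v t j i \<noteq> 0"
    using assms(9) by (simp add: coupling_def uj)
  have "attracts M lam v t j i"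
    using assms(7,8) c nz by (intro attracts_if_couplings_conjugate) auto
  moreover have "attracts M lam v t i j"
    using assms(7,8) c nz by (intro attracts_if_couplings_conjugate) auto
  ultimately show ?thesis
    by (simp add: attract_each_other_def)
qed

end
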